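(* For every integer $n\ge 4$, the star Cayley graph $Sym_n(st)$ satisfies $$N(Sym_n(st),1)=2\quad\text{and}\quad N(Sym_n(st),2)=2(n-1).$$
   Context: For an integer $n$, $Sym_n$ is the symmetric group on $\{1,\dots,n\}$. The star Cayley graph $Sym_n(st)$ is the Cayley graph with vertex set $Sym_n$ and edges $\{g,gs\}$ for $g\in Sym_n$, $s\in st$, where $st=\{(1,i): 1<i\le n\}$ is the set of prefix-transpositions ($(1,i)$ is the transposition interchanging $1$ and $i$). For a finite connected simple graph $\Gamma$ with vertex set $V(\Gamma)$ and path distance $d$, let $B_r(x)=\{y\in V(\Gamma): d(x,y)\le r\}$ and $$N(\Gamma,r)=\max_{x,y\in V(\Gamma),\ x\ne y}|B_r(x)\cap B_r(y)|.$$ *)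

theory Defs
  imports "HOL-Algebra.Sym_Groups" "Graph_Theory.Graph_Theory"
begin

text \<open>
  An undirected graph is a symmetric digraph, as in the locale \<^locale>\<open>graph\<close>: the edge
  \<open>{g, h}\<close> is the pair of arcs \<open>(g, h)\<close>, \<open>(h, g)\<close>.
\<close>

definition cayley_graph :: "('a, 'b) monoid_scheme \<Rightarrow> 'a set \<Rightarrow> ('a, 'a \<times> 'a) pre_digraph" where
  "cayley_graph G S =
     \<lparr> verts = carrier G,
       arcs = {(u, v). \<exists>g\<in>carrier G. \<exists>s\<in>S. {u, v} = {g, g \<otimes>\<^bsub>G\<^esub> s}},
       tail = fst,
       head = snd \<rparr>"

definition prefix_transpositions :: "nat \<Rightarrow> (nat \<Rightarrow> nat) set" where
  "prefix_transpositions n = {transpose 1 i | i. 1 < i \<and> i \<le> n}"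

definition star_cayley_graph ::
    "nat \<Rightarrow> (nat \<Rightarrow> nat, (nat \<Rightarrow> nat) \<times> (nat \<Rightarrow> nat)) pre_digraph" where
  "star_cayley_graph n = cayley_graph (sym_group n) (prefix_transpositions n)"

definition path_dist :: "('a, 'b) pre_digraph \<Rightarrow> 'a \<Rightarrow> 'a \<Rightarrow> ereal" where
  "path_dist G x y = wf_digraph.\<mu> G (\<lambda>_. 1) x y"

definition graph_ball :: "('a, 'b) pre_digraph \<Rightarrow> nat \<Rightarrow> 'a \<Rightarrow> 'a set" where
  "graph_ball G r x = {y \<in> verts G. path_dist G x y \<le> ereal (real r)}"

text \<open>
  Only meaningful if \<^term>\<open>verts G\<close> is finite and has at least two elements; otherwise
  \<^const>\<open>Max\<close> is applied to an empty or possibly infinite set.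
\<close>
definition max_ball_inter :: "('a, 'b) pre_digraph \<Rightarrow> nat \<Rightarrow> nat" where
  "max_ball_inter G r =
     Max {card (graph_ball G r x \<inter> graph_ball G r y) | x y.
            x \<in> verts G \<and> y \<in> verts G \<and> x \<noteq> y}"

lemma path_dist_le_iff:
  assumes "wf_digraph G"
  shows "path_dist G x y \<le> ereal (real r) \<longleftrightarrow>
         (\<exists>p. pre_digraph.awalk G x p y \<and> length p \<le> r)"
proof -
  interpret wf_digraph G by fact
  have cost: "awalk_cost (\<lambda>_. 1) p = real (length p)" for p :: "'b list"
    by (induction p) simp_all
  show ?thesis
  proof
    assume le: "path_dist G x y \<le> ereal (real r)"
    have "path_dist G x y < ereal (real (Suc r))"
      using le by (rule order.strict_trans1) simp
    then obtain p where "awalk x p y" "ereal (awalk_cost (\<lambda>_. 1) p) < ereal (real (Suc r))"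
      unfolding path_dist_def \<mu>_def INF_less_iff by blast
    then show "\<exists>p. awalk x p y \<and> length p \<le> r"
      by (intro exI[of _ p]) (simp add: cost)
  next
    assume "\<exists>p. awalk x p y \<and> length p \<le> r"
    then obtain p where p: "awalk x p y" "length p \<le> r" by blast
    have "path_dist G x y \<le> ereal (awalk_cost (\<lambda>_. 1) p)"
      unfolding path_dist_def by (rule min_cost_le_walk_cost[OF p(1)])
    also have "\<dots> \<le> ereal (real r)"
      using p(2) by (simp add: cost)
    finally show "path_dist G x y \<le> ereal (real r)" .
  qed
qed

lemma graph_cayley_graph:
  assumes "group G" "finite (carrier G)" "S \<subseteq> carrier G" "\<one>\<^bsub>G\<^esub> \<notin> S"
  shows "graph (cayley_graph G S)"
proof -
  interpret group G by fact
  let ?H = "cayley_graph G S"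
  have verts: "verts ?H = carrier G"
    and tail: "tail ?H = fst" and head: "head ?H = snd"
    by (simp_all add: cayley_graph_def)
  have A: "fst e \<in> carrier G \<and> snd e \<in> carrier G \<and> fst e \<noteq> snd e" if "e \<in> arcs ?H" for e
  proof -
    obtain u v where e: "e = (u, v)" by (cases e)
    with that obtain g s where gs: "g \<in> carrier G" "s \<in> S" "{u, v} = {g, g \<otimes>\<^bsub>G\<^esub> s}"
      unfolding cayley_graph_def by auto
    have "s \<in> carrier G" "s \<noteq> \<one>\<^bsub>G\<^esub>" using gs(2) assms(3,4) by blast+
    then have "g \<otimes>\<^bsub>G\<^esub> s \<in> carrier G" "g \<otimes>\<^bsub>G\<^esub> s \<noteq> g"
      using gs(1) by simp_all
    then show ?thesis using gs(1,3) e unfolding doubleton_eq_iff by auto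
  qed
  have fin: "finite (arcs ?H)"
  proof (rule finite_subset)
    show "arcs ?H \<subseteq> carrier G \<times> carrier G" using A by (fastforce simp: mem_Times_iff)
    show "finite (carrier G \<times> carrier G)" using assms(2) by simp
  qed
  have sym: "(v, u) \<in> arcs ?H" if "(u, v) \<in> arcs ?H" for u v
    using that unfolding cayley_graph_def by (simp add: insert_commute)
  interpret wf_digraph ?H
    by unfold_locales (simp_all add: A verts tail head)
  interpret digraph ?H
    by unfold_locales
      (use fin assms(2) A in \<open>simp_all add: verts tail head arc_to_ends_def prod_eq_iff\<close>)
  have "arcs_ends ?H = arcs ?H"
    by (simp add: arcs_ends_conv tail head)
  then have "symmetric ?H"
    unfolding symmetric_def sym_def using sym by blast
  then show ?thesis by (rule graphI)
qed

lemma graph_star_cayley_graph: "graph (star_cayley_graph n)"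
  unfolding star_cayley_graph_def
proof (rule graph_cayley_graph)
  show "group (sym_group n)" by (rule sym_group_is_group)
  show "finite (carrier (sym_group n))" by (simp add: sym_group_def finite_permutations)
  show "prefix_transpositions n \<subseteq> carrier (sym_group n)"
    by (auto simp: prefix_transpositions_def sym_group_carrier intro!: permutes_swap_id)
  show "\<one>\<^bsub>sym_group n\<^esub> \<notin> prefix_transpositions n"
    by (auto simp: prefix_transpositions_def sym_group_one transpose_eq_id_iff
        dest: sym[of id])
qed

lemma connected_star_cayley_graph:
  assumes "n \<ge> 1"
  shows "connected (star_cayley_graph n)"
proof -
  let ?G = "star_cayley_graph n"
  interpret graph ?G by (rule graph_star_cayley_graph)
  have verts: "verts ?G = {p. p permutes {1..n}}"
    by (simp add: star_cayley_graph_def cayley_graph_def sym_group_def)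
  have step: "p \<rightarrow>\<^sup>*\<^bsub>?G\<^esub> (p \<circ> transpose 1 i)" if "p permutes {1..n}" "i \<in> {1..n}" for p i
  proof (cases "i = 1")
    case True
    then show ?thesis using that by (simp add: reachable_refl verts)
  next
    case False
    then have "transpose 1 i \<in> prefix_transpositions n"
      using that by (auto simp: prefix_transpositions_def)
    then have "(p, p \<circ> transpose 1 i) \<in> arcs ?G"
      using that(1) unfolding star_cayley_graph_def cayley_graph_def sym_group_def by auto
    then have "arc_to_ends ?G (p, p \<circ> transpose 1 i) \<in> arcs_ends ?G"
      unfolding arcs_ends_def by (rule imageI)
    then have "p \<rightarrow>\<^bsub>?G\<^esub> (p \<circ> transpose 1 i)"
      by (simp add: arc_to_ends_def star_cayley_graph_def cayley_graph_def)
    then show ?thesis by (rule reachable_adjI)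
  qed
  have perm: "p \<circ> transpose 1 i permutes {1..n}" if "p permutes {1..n}" "i \<in> {1..n}" for p i
    using that assms by (intro permutes_compose permutes_swap_id) auto
  have id: "id \<rightarrow>\<^sup>*\<^bsub>?G\<^esub> p" if "p permutes {1..n}" for p
    using finite_atLeastAtMost[of 1 n] that
  proof (induction rule: permutes_rev_induct)
    case id
    have "id \<in> verts ?G" unfolding verts mem_Collect_eq by (rule permutes_id)
    then show ?case by (rule reachable_refl)
  next
    case (swap a b p)
    have *: "\<exists>b'\<in>{1..n}. \<exists>a'\<in>{1..n}. transpose a b = transpose 1 a' \<circ> transpose 1 b' \<circ> transpose 1 a'"
    proof (cases "b = 1")
      case True
      then show ?thesis using swap.hyps
        by (intro bexI[of _ a] bexI[of _ 1]) (auto simp: transpose_commute)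
    next
      case False
      then show ?thesis using swap.hyps transpose_comp_triple[of a b 1]
        by (intro bexI[of _ b] bexI[of _ a]) (auto simp: transpose_commute)
    qed
    then obtain a' b' where ab: "a' \<in> {1..n}" "b' \<in> {1..n}"
      "transpose a b = transpose 1 a' \<circ> transpose 1 b' \<circ> transpose 1 a'" by blast
    let ?p1 = "p \<circ> transpose 1 a'"
    let ?p2 = "?p1 \<circ> transpose 1 b'"
    let ?p3 = "?p2 \<circ> transpose 1 a'"
    have p1: "?p1 permutes {1..n}" by (rule perm[OF swap.hyps(4) ab(1)])
    have p2: "?p2 permutes {1..n}" by (rule perm[OF p1 ab(2)])
    note swap.IH
    also note step[OF swap.hyps(4) ab(1)]
    also note step[OF p1 ab(2)]
    also note step[OF p2 ab(1)]
    finally show ?case unfolding ab(3) o_assoc .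
  qed
  have "p \<rightarrow>\<^sup>*\<^bsub>?G\<^esub> q" if "p \<in> verts ?G" "q \<in> verts ?G" for p q
    using symmetric_reachable'[OF id] id reachable_trans that unfolding verts mem_Collect_eq by metis
  moreover have "verts ?G \<noteq> {}"
    unfolding verts using permutes_id by blast
  ultimately show ?thesis
    unfolding connected_def strongly_connected_def
    by (simp add: reachable_mk_symmetric_eq[OF sym_arcs])
qed

end

theory Submission
  imports Defs
begin

text \<open>
  By left translation only the balls around the identity and around some \<open>z \<noteq> id\<close> matter.
  The ball of radius 2 around the identity consists of the even elements (the identity and
  the 3-cycles moving 1) and the odd ones (the star transpositions). If \<open>z\<close> is odd, parity
  forces every element of the intersection into one of the two unit spheres, whose union has
  \<open>2 * (n - 1)\<close> elements; for \<open>z\<close> adjacent to the identity this is attained. If \<open>z\<close> is even,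
  the odd elements are common neighbours, of which there is at most one. An even element
  \<open>y\<close> gives a factorization of \<open>z\<close> into two of these 3-cycles (or the identity), and tracking
  1 through it shows that \<open>y\<close> is determined, up to few exceptions, by a single parameter
  \<open>j \<noteq> 1\<close> together with \<open>z\<close>; the three cases are \<open>z 1 = 1\<close>, \<open>z\<close> swapping 1 and \<open>z 1\<close>, and neither.
\<close>

section \<open>Balls in digraphs\<close>

lemma graph_ball_0:
  assumes "wf_digraph G" "x \<in> verts G"
  shows "graph_ball G 0 x = {x}"
proof -
  interpret wf_digraph G by fact
  show ?thesis
    using assms(2) unfolding graph_ball_def
    by (auto simp: path_dist_le_iff[OF assms(1)] awalk_Nil_iff simp del: of_nat_0)
qed

text \<open>Cut a walk at its first arc. The centre is inserted by hand because the empty walk has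
  no first arc.\<close>

lemma graph_ball_Suc:
  assumes "wf_digraph G" "x \<in> verts G"
  shows "graph_ball G (Suc r) x = insert x (\<Union>y\<in>{y. x \<rightarrow>\<^bsub>G\<^esub> y}. graph_ball G r y)"
proof -
  interpret wf_digraph G by fact
  have "(\<exists>p. awalk x p z \<and> length p \<le> Suc r) \<longleftrightarrow>
      z = x \<or> (\<exists>y. x \<rightarrow>\<^bsub>G\<^esub> y \<and> (\<exists>p. awalk y p z \<and> length p \<le> r))" for z
  proof
    assume "\<exists>p. awalk x p z \<and> length p \<le> Suc r"
    then obtain p where p: "awalk x p z" "length p \<le> Suc r" by blast
    show "z = x \<or> (\<exists>y. x \<rightarrow>\<^bsub>G\<^esub> y \<and> (\<exists>p. awalk y p z \<and> length p \<le> r))"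
    proof (cases p)
      case Nil
      then show ?thesis using p by (simp add: awalk_Nil_iff)
    next
      case (Cons e q)
      then have "e \<in> arcs G" "tail G e = x" "awalk (head G e) q z"
        using p(1) by (simp_all add: awalk_Cons_iff)
      then show ?thesis using p(2) Cons in_arcs_imp_in_arcs_ends[of e] by auto
    qed
  next
    assume "z = x \<or> (\<exists>y. x \<rightarrow>\<^bsub>G\<^esub> y \<and> (\<exists>p. awalk y p z \<and> length p \<le> r))"
    then show "\<exists>p. awalk x p z \<and> length p \<le> Suc r"
    proof (elim disjE exE conjE)
      assume "z = x"
      then show ?thesis using assms(2) by (intro exI[of _ "[]"]) (simp add: awalk_Nil_iff)
    next
      fix y p
      assume y: "x \<rightarrow>\<^bsub>G\<^esub> y" "awalk y p z" "length p \<le> r"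
      then obtain e where "e \<in> arcs G" "tail G e = x" "head G e = y"
        by (auto simp: arcs_ends_def arc_to_ends_def)
      then show ?thesis using y by (intro exI[of _ "e # p"]) (simp add: awalk_Cons_iff)
    qed
  qed
  then show ?thesis
    using assms(2) unfolding graph_ball_def
    by (auto simp: path_dist_le_iff[OF assms(1)] simp del: of_nat_Suc)
qed

section \<open>Words of length at most two in the star transpositions\<close>

text \<open>Each product sends 1 to \<open>j\<close>, \<open>j\<close> to \<open>i\<close> and
  \<open>i\<close> to 1, so these are exactly the 3-cycles on \<open>{1..n}\<close> that move
  1.\<close>

definition star_three_cycles :: "nat \<Rightarrow> (nat \<Rightarrow> nat) set" where
  "star_three_cycles n =
     {transpose 1 i \<circ> transpose 1 j | i j. i \<in> {1<..n} \<and> j \<in> {1<..n} \<and> i \<noteq> j}"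

lemma prefix_transpositions_conv_image: "prefix_transpositions n = transpose 1 ` {1<..n}"
  by (auto simp: prefix_transpositions_def)

lemma finite_prefix_transpositions [simp]: "finite (prefix_transpositions n)"
  by (simp add: prefix_transpositions_conv_image)

lemma card_prefix_transpositions: "card (prefix_transpositions n) = n - 1"
proof -
  have "inj_on (transpose 1) {1<..n}"
    by (rule inj_onI) (metis transpose_apply_first)
  then show ?thesis by (simp add: prefix_transpositions_conv_image card_image)
qed

lemma finite_star_three_cycles [simp]: "finite (star_three_cycles n)"
  by (rule finite_subset[of _ "(\<lambda>(i, j). transpose 1 i \<circ> transpose 1 j) ` ({1<..n} \<times> {1<..n})"])
    (auto simp: star_three_cycles_def)

lemma prefix_transposition_permutes: "t \<in> prefix_transpositions n \<Longrightarrow> t permutes {1..n}"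
  by (auto simp: prefix_transpositions_def intro!: permutes_swap_id)

lemma comp_prefix_transpositions:
  assumes "s \<in> prefix_transpositions n" "t \<in> prefix_transpositions n"
  shows "s \<circ> t \<in> insert id (star_three_cycles n)"
proof -
  obtain i j where "i \<in> {1<..n}" "j \<in> {1<..n}" "s = transpose 1 i" "t = transpose 1 j"
    using assms unfolding prefix_transpositions_conv_image by blast
  then show ?thesis
    by (cases "i = j") (auto simp only: star_three_cycles_def transpose_comp_involutory)
qed

lemma three_cycle_permutes: "t \<in> star_three_cycles n \<Longrightarrow> t permutes {1..n}"
  unfolding star_three_cycles_def
  by (auto intro!: permutes_compose permutes_swap_id)

section \<open>Parity of generators and of 3-cycles\<close>

lemma prefix_transposition_parity:
  assumes "t \<in> prefix_transpositions n" "z permutes {1..n}"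
  shows "\<not> evenperm t" "evenperm (z \<circ> t) \<longleftrightarrow> \<not> evenperm z"
proof -
  show odd: "\<not> evenperm t"
    using assms(1) by (auto simp: prefix_transpositions_def evenperm_swap)
  have "permutation z" "permutation t"
    using assms(2) prefix_transposition_permutes[OF assms(1)] permutation_permutes by blast+
  then show "evenperm (z \<circ> t) \<longleftrightarrow> \<not> evenperm z"
    using odd by (simp add: evenperm_comp)
qed

lemma three_cycle_parity:
  assumes "t \<in> insert id (star_three_cycles n)" "z permutes {1..n}"
  shows "evenperm t" "evenperm (z \<circ> t) \<longleftrightarrow> evenperm z"
proof -
  show even: "evenperm t"
    using assms(1)
    by (auto simp: star_three_cycles_def evenperm_swap evenperm_comp permutation_swap_id)
  have "t permutes {1..n}"
    using assms(1) three_cycle_permutes permutes_id by blast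
  then have "permutation z" "permutation t"
    using assms(2) permutation_permutes by blast+
  then show "evenperm (z \<circ> t) \<longleftrightarrow> evenperm z"
    using even by (simp add: evenperm_comp)
qed

section \<open>Adjacency and balls in the star graph\<close>

text \<open>Arcs are given by unordered pairs \<open>{g, g \<circ> s}\<close>, so \<open>x\<close>
  may be either end. As \<open>s\<close> is an involution, both readings make \<open>y\<close> a
  right multiple of \<open>x\<close> by \<open>s\<close>.\<close>

lemma star_adj_iff:
  assumes "x permutes {1..n}"
  shows "x \<rightarrow>\<^bsub>star_cayley_graph n\<^esub> y \<longleftrightarrow> y \<in> (\<circ>) x ` prefix_transpositions n"
proof -
  have "x \<rightarrow>\<^bsub>star_cayley_graph n\<^esub> y \<longleftrightarrow>
      (\<exists>g s. g permutes {1..n} \<and> s \<in> prefix_transpositions n \<and> {x, y} = {g, g \<circ> s})"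
    by (auto simp: arcs_ends_def arc_to_ends_def star_cayley_graph_def cayley_graph_def
        sym_group_def image_iff)
  also have "\<dots> \<longleftrightarrow> (\<exists>s\<in>prefix_transpositions n. y = x \<circ> s)"
  proof (intro iffI; elim exE conjE bexE)
    fix g s
    assume gs: "g permutes {1..n}" "s \<in> prefix_transpositions n" "{x, y} = {g, g \<circ> s}"
    have "s \<circ> s = id" using gs(2) by (auto simp: prefix_transpositions_def)
    then have "g = g \<circ> s \<circ> s" by (simp add: comp_assoc)
    then show "\<exists>s\<in>prefix_transpositions n. y = x \<circ> s"
      using gs(2,3) unfolding doubleton_eq_iff by blast
  qed (use assms in blast)
  finally show ?thesis by blast
qed

lemma verts_star_cayley_graph: "verts (star_cayley_graph n) = {p. p permutes {1..n}}"
  by (simp add: star_cayley_graph_def cayley_graph_def sym_group_def)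

lemma wf_star_cayley_graph: "wf_digraph (star_cayley_graph n)"
proof -
  interpret graph "star_cayley_graph n" by (rule graph_star_cayley_graph)
  show ?thesis by (rule wf_digraph_axioms)
qed

lemma star_ball_1:
  assumes "x permutes {1..n}"
  shows "graph_ball (star_cayley_graph n) 1 x = (\<circ>) x ` insert id (prefix_transpositions n)"
proof -
  have "graph_ball (star_cayley_graph n) 0 (x \<circ> s) = {x \<circ> s}"
    if "s \<in> prefix_transpositions n" for s
    using permutes_compose[OF prefix_transposition_permutes[OF that] assms]
    by (simp add: graph_ball_0[OF wf_star_cayley_graph] verts_star_cayley_graph)
  then show ?thesis
    using assms graph_ball_Suc[OF wf_star_cayley_graph, of x n 0]
    by (auto simp: verts_star_cayley_graph star_adj_iff)
qed

text \<open>The recursion for balls gives all words of length at most two. They are grouped by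
  parity, even words first, because the count later splits along this line.\<close>

lemma star_ball_2:
  assumes "x permutes {1..n}"
  shows "graph_ball (star_cayley_graph n) 2 x =
    (\<circ>) x ` (insert id (star_three_cycles n) \<union> prefix_transpositions n)" (is "?B = ?R")
proof -
  have "graph_ball (star_cayley_graph n) (Suc 0) (x \<circ> s)
      = insert (x \<circ> s) ((\<lambda>t. x \<circ> s \<circ> t) ` prefix_transpositions n)"
    if "s \<in> prefix_transpositions n" for s
    using star_ball_1[OF permutes_compose[OF prefix_transposition_permutes[OF that] assms]]
    by simp
  then have B: "?B = insert x (\<Union>s\<in>prefix_transpositions n.
      insert (x \<circ> s) ((\<lambda>t. x \<circ> s \<circ> t) ` prefix_transpositions n))"
    using assms graph_ball_Suc[OF wf_star_cayley_graph, of x n 1]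
    by (auto simp: verts_star_cayley_graph star_adj_iff numeral_2_eq_2)
  have words: "x \<circ> s \<circ> t \<in> (\<circ>) x ` insert id (star_three_cycles n)"
    if "s \<in> prefix_transpositions n" "t \<in> prefix_transpositions n" for s t
    unfolding comp_assoc using comp_prefix_transpositions[OF that] by (rule imageI)
  have "?B \<subseteq> ?R"
    unfolding B using words by fastforce
  moreover have "?R \<subseteq> ?B"
    unfolding B prefix_transpositions_conv_image star_three_cycles_def
    by (auto simp: comp_assoc)
  ultimately show ?thesis by blast
qed

section \<open>Counting intersections of balls\<close>

text \<open>A common neighbour of \<open>id\<close> and \<open>z\<close> gives \<open>z\<close> = (1
  i)(1 j) with \<open>i \<noteq> j\<close>. Then \<open>z\<close> maps 1 to \<open>j\<close> and
  \<open>j\<close> to \<open>i\<close>, so \<open>i\<close> can be read off from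
  \<open>z\<close>.\<close>

lemma common_neighbours_subset:
  assumes "z \<noteq> id"
  shows "prefix_transpositions n \<inter> (\<circ>) z ` prefix_transpositions n \<subseteq> {transpose 1 (z (z 1))}"
proof
  fix y
  assume "y \<in> prefix_transpositions n \<inter> (\<circ>) z ` prefix_transpositions n"
  then obtain i j where ij: "1 < i" "1 < j" "y = transpose 1 i" "y = z \<circ> transpose 1 j"
    by (auto simp: prefix_transpositions_def)
  have z: "z = transpose 1 i \<circ> transpose 1 j"
    using ij(3,4) by (metis comp_assoc comp_id transpose_comp_involutory)
  with assms have "i \<noteq> j" by auto
  then show "y \<in> {transpose 1 (z (z 1))}"
    using ij(1-3) by (simp add: z transpose_def)
qed

section \<open>Factorizations into two 3-cycles moving 1\<close>

text \<open>Reversing the two transpositions inverts the product. This turns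
  \<open>y = z \<circ> u\<close> into a factorization \<open>z = y \<circ> w\<close>.\<close>

lemma three_cycle_inverse:
  assumes "u \<in> insert id (star_three_cycles n)"
  obtains w where "w \<in> insert id (star_three_cycles n)" "u \<circ> w = id"
proof (cases "u = id")
  case False
  then obtain i j where ij: "u = transpose 1 i \<circ> transpose 1 j"
      "i \<in> {1<..n}" "j \<in> {1<..n}" "i \<noteq> j"
    using assms by (auto simp: star_three_cycles_def)
  have "transpose 1 j \<circ> transpose 1 i \<in> star_three_cycles n"
    using ij by (auto simp: star_three_cycles_def)
  moreover have "u \<circ> (transpose 1 j \<circ> transpose 1 i) = id"
    unfolding ij(1) by (metis comp_assoc comp_id transpose_comp_involutory)
  ultimately show ?thesis using that by blast
qed (use that[of id] in simp)

lemma star_three_cycle_first: "u \<in> star_three_cycles n \<Longrightarrow> u 1 \<noteq> 1"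
  by (auto simp: star_three_cycles_def transpose_def)

text \<open>Records the cycle 1, j, i pointwise, so that the factor lemmas below can trace single
  points through a product.\<close>

lemma star_three_cycle_cases:
  assumes "u \<in> insert id (star_three_cycles n)" "u \<noteq> id"
  obtains i j where "u = transpose 1 i \<circ> transpose 1 j" "i \<in> {1<..n}" "j \<in> {1<..n}"
    "i \<noteq> j" "i \<noteq> 1" "j \<noteq> 1"
    and "u 1 = j" "u j = i" "u i = 1" "\<And>x. x \<notin> {1, i, j} \<Longrightarrow> u x = x"
proof -
  obtain i j where u: "u = transpose 1 i \<circ> transpose 1 j" "i \<in> {1<..n}" "j \<in> {1<..n}" "i \<noteq> j"
    using assms unfolding star_three_cycles_def by blast
  then have "i \<noteq> 1" "j \<noteq> 1" by auto
  with u show ?thesis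
    by (intro that[of i j]) (simp_all add: transpose_def)
qed

text \<open>If one factor were \<open>id\<close>, the other would be \<open>z\<close>, a 3-cycle
  moving 1. Otherwise \<open>w\<close> must send 1 to the point \<open>i\<close> that
  \<open>y\<close> sends back to 1.\<close>

lemma three_cycle_factor_fixing:
  assumes y: "y \<in> insert id (star_three_cycles n)" and w: "w \<in> insert id (star_three_cycles n)"
    and z: "z = y \<circ> w" "z \<noteq> id" "z 1 = 1"
  shows "\<exists>j\<in>{1<..n}. y = transpose 1 (z j) \<circ> transpose 1 j"
proof -
  have "y \<noteq> id" "w \<noteq> id"
    using assms star_three_cycle_first by auto
  from y \<open>y \<noteq> id\<close> obtain i j
    where ij: "y = transpose 1 i \<circ> transpose 1 j" "i \<in> {1<..n}" "j \<in> {1<..n}"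
      "i \<noteq> j" "i \<noteq> 1" "j \<noteq> 1"
      and yx: "y 1 = j" "y j = i" "y i = 1" "\<And>x. x \<notin> {1, i, j} \<Longrightarrow> y x = x"
    by (rule star_three_cycle_cases) blast
  from w \<open>w \<noteq> id\<close> obtain k l
    where kl: "w = transpose 1 k \<circ> transpose 1 l" "k \<in> {1<..n}" "l \<in> {1<..n}"
      "k \<noteq> l" "k \<noteq> 1" "l \<noteq> 1"
      and wx: "w 1 = l" "w l = k" "w k = 1" "\<And>x. x \<notin> {1, k, l} \<Longrightarrow> w x = x"
    by (rule star_three_cycle_cases) blast
  have zx: "z x = y (w x)" for x by (simp add: z(1))
  have "l = i"
    using z(3) zx[of 1] wx(1) yx ij(4-6) kl(6) by (metis empty_iff insert_iff)
  \<comment> \<open>With \<open>l = i\<close>, the choice \<open>k = j\<close> would make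
    \<open>w\<close> the inverse of \<open>y\<close>. Excluding it leaves \<open>j\<close> fixed by
    \<open>w\<close>, so \<open>z j = y j = i\<close>.\<close>
  moreover have "k \<noteq> j"
  proof
    assume "k = j"
    then have "z x = x" for x
      using zx[of x] yx wx \<open>l = i\<close> by (metis empty_iff insert_iff)
    then show False using z(2) by auto
  qed
  ultimately have "z j = i"
    using zx[of j] ij(4-6) wx(4)[of j] yx(2) by (metis empty_iff insert_iff)
  then show ?thesis using ij(1,3) by blast
qed

text \<open>Here \<open>z\<close> contains the 2-cycle (1 m), which no 3-cycle does, so both factors
  are proper. The two families are distinguished by whether the preimage \<open>i\<close> of 1 under
  \<open>y\<close> equals \<open>m\<close>.\<close>

lemma three_cycle_factor_swapping:
  assumes y: "y \<in> insert id (star_three_cycles n)" and w: "w \<in> insert id (star_three_cycles n)"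
    and z: "z = y \<circ> w" "z 1 = m" "m \<noteq> 1" "z m = 1"
  shows "(\<exists>i\<in>{1<..n} - {m}. y = transpose 1 i \<circ> transpose 1 (z i)) \<or>
    (\<exists>j\<in>{1<..n} - {m}. y = transpose 1 m \<circ> transpose 1 j)"
proof -
  have no_swap: "u (u 1) \<noteq> 1" if u: "u \<in> insert id (star_three_cycles n)" "u 1 \<noteq> 1" for u
  proof -
    from u(2) have "u \<noteq> id" by auto
    with u(1) show ?thesis by (rule star_three_cycle_cases) simp
  qed
  have "y \<noteq> id" "w \<noteq> id"
    using no_swap[OF w] no_swap[OF y] z by auto
  from y \<open>y \<noteq> id\<close> obtain i j
    where ij: "y = transpose 1 i \<circ> transpose 1 j" "i \<in> {1<..n}" "j \<in> {1<..n}"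
      "i \<noteq> j" "i \<noteq> 1" "j \<noteq> 1"
      and yx: "y 1 = j" "y j = i" "y i = 1" "\<And>x. x \<notin> {1, i, j} \<Longrightarrow> y x = x"
    by (rule star_three_cycle_cases) blast
  from w \<open>w \<noteq> id\<close> obtain k l
    where kl: "w = transpose 1 k \<circ> transpose 1 l" "k \<in> {1<..n}" "l \<in> {1<..n}"
      "k \<noteq> l" "k \<noteq> 1" "l \<noteq> 1"
      and wx: "w 1 = l" "w l = k" "w k = 1" "\<And>x. x \<notin> {1, k, l} \<Longrightarrow> w x = x"
    by (rule star_three_cycle_cases) blast
  have zx: "z x = y (w x)" for x by (simp add: z(1))
  have yl: "y l = m"
    using z(2) zx[of 1] wx(1) by simp
  have wm: "w m = i"
    using z(4) zx[of m] yx ij(4-6) by (metis empty_iff insert_iff)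
  have "z i = j" if "i \<noteq> m"
  proof -
    \<comment> \<open>\<open>y\<close> sends \<open>l\<close> to \<open>m\<close>. Since
      \<open>m\<close> is neither 1 nor \<open>i\<close>, the values of \<open>y\<close> at
      \<open>i\<close> and \<open>j\<close>, the point \<open>l\<close> must be fixed by
      \<open>y\<close>.\<close>
    have "m = l"
      using yl yx z(3) kl(6) that by (metis empty_iff insert_iff)
    then have "k = i" using wm wx(2) by simp
    then show ?thesis using wx(3) yx(1) by (simp add: zx)
  qed
  show ?thesis
  proof (cases "i = m")
    case True
    then have "j \<in> {1<..n} - {m}" using ij(3,4) by simp
    then show ?thesis using ij(1) True by blast
  next
    case False
    then have "i \<in> {1<..n} - {m}" using ij(2) by simp
    then show ?thesis using ij(1) \<open>i \<noteq> m \<Longrightarrow> z i = j\<close>[OF False] by metis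
  qed
qed

text \<open>\<open>w\<close> must send \<open>p\<close> to the point \<open>i\<close> that
  \<open>y\<close> maps to 1. If \<open>w\<close> fixes \<open>p\<close>, then \<open>i = p\<close>
  and only \<open>j\<close> is free; if it moves \<open>p\<close>, all of \<open>y\<close> is
  forced.\<close>

lemma three_cycle_factor_generic:
  assumes y: "y \<in> insert id (star_three_cycles n)" and w: "w \<in> insert id (star_three_cycles n)"
    and z: "z = y \<circ> w" "z 1 = m" "m \<noteq> 1" "z p = 1" "p \<noteq> m"
  shows "y \<in> {id, transpose 1 m \<circ> transpose 1 p} \<or>
    (\<exists>j\<in>{1<..n} - {p}. y = transpose 1 p \<circ> transpose 1 j)"
proof (cases "y = id")
  case False
  from y False obtain i j
    where ij: "y = transpose 1 i \<circ> transpose 1 j" "i \<in> {1<..n}" "j \<in> {1<..n}"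
      "i \<noteq> j" "i \<noteq> 1" "j \<noteq> 1"
      and yx: "y 1 = j" "y j = i" "y i = 1" "\<And>x. x \<notin> {1, i, j} \<Longrightarrow> y x = x"
    by (rule star_three_cycle_cases) blast
  have zx: "z x = y (w x)" for x by (simp add: z(1))
  have wp: "w p = i"
    using z(4) zx[of p] yx ij(4-6) by (metis empty_iff insert_iff)
  have "i = m \<and> j = p" if "i \<noteq> p"
  proof -
    have "w \<noteq> id" using wp that by auto
    from w \<open>w \<noteq> id\<close> obtain k l
      where kl: "w = transpose 1 k \<circ> transpose 1 l" "k \<in> {1<..n}" "l \<in> {1<..n}"
        "k \<noteq> l" "k \<noteq> 1" "l \<noteq> 1"
        and wx: "w 1 = l" "w l = k" "w k = 1" "\<And>x. x \<notin> {1, k, l} \<Longrightarrow> w x = x"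
      by (rule star_three_cycle_cases) blast
    have yl: "y l = m"
      using z(2) zx[of 1] wx(1) by simp
    \<comment> \<open>\<open>w\<close> moves \<open>p\<close>, and neither \<open>p = 1\<close> nor
      \<open>p = k\<close> is possible: the former contradicts \<open>m \<noteq> 1\<close>, the
      latter \<open>i \<noteq> 1\<close>.\<close>
    have "p = l"
      using wp wx that ij(5) z(2-4) by (metis empty_iff insert_iff)
    then have "p = j"
      using yl yx z(3,5) by (metis empty_iff insert_iff that kl(6))
    then show ?thesis using yl yx(2) \<open>p = l\<close> by simp
  qed
  note im = this
  show ?thesis
  proof (cases "i = p")
    case True
    then have "j \<in> {1<..n} - {p}" using ij(3,4) by simp
    then show ?thesis using ij(1) True by blast
  qed (use im ij(1) in simp)
qed simp

text \<open>The three cases give at most n-1, 2(n-2) and n elements. The bound 2n-3 covers all of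
  them for \<open>n \<ge> 3\<close> and leaves room for one odd element below 2(n-1).\<close>

lemma card_three_cycle_factors:
  assumes "n \<ge> 3" "z permutes {1..n}" "z \<noteq> id"
  shows "card (insert id (star_three_cycles n) \<inter> (\<circ>) z ` insert id (star_three_cycles n)) \<le> 2 * n - 3"
    (is "card ?E \<le> _")
proof -
  have E: "\<exists>w\<in>insert id (star_three_cycles n). z = y \<circ> w" if y: "y \<in> ?E" for y
  proof -
    obtain u where u: "u \<in> insert id (star_three_cycles n)" "y = z \<circ> u"
      using y by blast
    obtain w where "w \<in> insert id (star_three_cycles n)" "u \<circ> w = id"
      using three_cycle_inverse[OF u(1)] by blast
    then show ?thesis using u(2) by (intro bexI[of _ w]) (simp_all add: comp_assoc)
  qed
  let ?I = "{1<..n}"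
  have m: "z 1 \<in> {1..n}" unfolding permutes_in_image[OF assms(2)] using assms(1) by simp
  consider "z 1 = 1" | "z 1 \<noteq> 1" "z (z 1) = 1" | "z 1 \<noteq> 1" "z (z 1) \<noteq> 1" by blast
  then show ?thesis
  proof cases
    case 1
    let ?f = "\<lambda>j. transpose 1 (z j) \<circ> transpose 1 j"
    have sub: "?E \<subseteq> ?f ` ?I"
      using E three_cycle_factor_fixing[OF _ _ _ assms(3) 1] by blast
    have "card ?E \<le> card ?I"
      by (rule surj_card_le[OF _ sub]) simp
    also have "card ?I = n - 1" by simp
    finally show ?thesis using assms(1) by linarith
  next
    case 2
    let ?J = "?I - {z 1}"
    let ?f = "\<lambda>i. transpose 1 i \<circ> transpose 1 (z i)"
    let ?g = "\<lambda>j. transpose 1 (z 1) \<circ> transpose 1 j"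
    have "?E \<subseteq> ?f ` ?J \<union> ?g ` ?J"
      using E three_cycle_factor_swapping[OF _ _ _ refl 2] by blast
    then have "card ?E \<le> card (?f ` ?J \<union> ?g ` ?J)"
      by (intro card_mono) auto
    also have "\<dots> \<le> card ?J + card ?J"
      by (intro order_trans[OF card_Un_le] add_mono card_image_le) auto
    also have "card ?J = n - 2" using m 2 by (subst card_Diff_singleton) auto
    finally show ?thesis using assms(1) by linarith
  next
    case 3
    \<comment> \<open>The preimage of 1 differs from 1 and from \<open>z 1\<close>, as 1 is neither
      fixed nor in a 2-cycle of \<open>z\<close>.\<close>
    obtain p where p: "z p = 1" using permutes_surj[OF assms(2)] by (metis surjD)
    have "p \<in> {1..n}"
      unfolding permutes_in_image[OF assms(2), of p, symmetric] p using assms(1) by simp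
    moreover have "p \<noteq> 1" "p \<noteq> z 1" using p 3 by auto
    ultimately have pI: "p \<in> ?I" by simp
    let ?J = "?I - {p}"
    let ?g = "\<lambda>j. transpose 1 p \<circ> transpose 1 j"
    let ?D = "{id, transpose 1 (z 1) \<circ> transpose 1 p}"
    have "?E \<subseteq> ?D \<union> ?g ` ?J"
      using E three_cycle_factor_generic[OF _ _ _ refl 3(1) p \<open>p \<noteq> z 1\<close>] by blast
    then have "card ?E \<le> card (?D \<union> ?g ` ?J)"
      by (intro card_mono) auto
    also have "\<dots> \<le> 2 + card ?J"
      by (intro order_trans[OF card_Un_le] add_mono card_image_le)
        (auto simp: card_insert_if)
    also have "card ?J = n - 2" using pI by (subst card_Diff_singleton) auto
    finally show ?thesis using assms(1) by linarith
  qed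
qed

section \<open>Parity splitting and upper bounds\<close>

text \<open>Multiplication by an even \<open>z\<close> keeps the parity class of \<open>u\<close>;
  an odd \<open>z\<close> changes it, so one of \<open>u\<close> and \<open>z \<circ> u\<close> is a
  transposition.\<close>

lemma star_word_parity:
  assumes "z permutes {1..n}"
    and "u \<in> insert id (star_three_cycles n) \<union> prefix_transpositions n"
    and "z \<circ> u \<in> insert id (star_three_cycles n) \<union> prefix_transpositions n"
  shows "evenperm z \<Longrightarrow>
      u \<in> insert id (star_three_cycles n) \<and> z \<circ> u \<in> insert id (star_three_cycles n) \<or>
      u \<in> prefix_transpositions n \<and> z \<circ> u \<in> prefix_transpositions n"
    and "\<not> evenperm z \<Longrightarrow> z \<circ> u \<in> prefix_transpositions n \<or> u \<in> prefix_transpositions n"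
proof -
  let ?A = "insert id (star_three_cycles n)" and ?T = "prefix_transpositions n"
  have u: "u \<in> ?A \<Longrightarrow> evenperm (z \<circ> u) \<longleftrightarrow> evenperm z"
    "u \<in> ?T \<Longrightarrow> evenperm (z \<circ> u) \<longleftrightarrow> \<not> evenperm z"
    using three_cycle_parity(2)[OF _ assms(1)] prefix_transposition_parity(2)[OF _ assms(1)]
    by simp_all
  have zu: "z \<circ> u \<in> ?A \<Longrightarrow> evenperm (z \<circ> u)" "z \<circ> u \<in> ?T \<Longrightarrow> \<not> evenperm (z \<circ> u)"
    by (rule three_cycle_parity(1)[OF _ assms(1)], assumption)
      (rule prefix_transposition_parity(1)[OF _ assms(1)])
  from assms(2) assms(3)
  show "evenperm z \<Longrightarrow> u \<in> ?A \<and> z \<circ> u \<in> ?A \<or> u \<in> ?T \<and> z \<circ> u \<in> ?T"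
    and "\<not> evenperm z \<Longrightarrow> z \<circ> u \<in> ?T \<or> u \<in> ?T"
    unfolding Un_iff using u zu by argo+
qed

lemma Int_comp_imageE:
  assumes "y \<in> A \<inter> (\<circ>) z ` B"
  obtains u where "u \<in> B" "z \<circ> u \<in> A" "y = z \<circ> u"
proof -
  from assms have "y \<in> A" "y \<in> (\<circ>) z ` B" by simp_all
  then show ?thesis by (elim imageE) (use that in simp)
qed

text \<open>Both parities reach the same number: (2n-3)+1 for even \<open>z\<close>, two sets of n-1
  elements for odd \<open>z\<close>.\<close>

lemma card_ball_2_inter_le:
  assumes "n \<ge> 3" "z permutes {1..n}" "z \<noteq> id"
  defines "S \<equiv> insert id (star_three_cycles n) \<union> prefix_transpositions n"
  shows "card (S \<inter> (\<circ>) z ` S) \<le> 2 * (n - 1)"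
proof -
  let ?A = "insert id (star_three_cycles n)" and ?T = "prefix_transpositions n"
  show ?thesis
  proof (cases "evenperm z")
    case True
    let ?E = "?A \<inter> (\<circ>) z ` ?A" and ?O = "?T \<inter> (\<circ>) z ` ?T"
    have "S \<inter> (\<circ>) z ` S \<subseteq> ?E \<union> ?O"
    proof
      fix y
      assume "y \<in> S \<inter> (\<circ>) z ` S"
      then obtain u where u: "u \<in> ?A \<union> ?T" "z \<circ> u \<in> ?A \<union> ?T" "y = z \<circ> u"
        unfolding S_def by (rule Int_comp_imageE)
      have "u \<in> ?A \<and> z \<circ> u \<in> ?A \<or> u \<in> ?T \<and> z \<circ> u \<in> ?T"
        by (rule star_word_parity(1)[OF assms(2) u(1,2) True])
      then show "y \<in> ?E \<union> ?O"
        unfolding u(3) by (metis IntI UnI1 UnI2 imageI)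
    qed
    then have "card (S \<inter> (\<circ>) z ` S) \<le> card (?E \<union> ?O)"
      by (intro card_mono) simp_all
    moreover have "card (?E \<union> ?O) \<le> card ?E + card ?O" by (rule card_Un_le)
    moreover have "card ?E \<le> 2 * n - 3" by (rule card_three_cycle_factors[OF assms(1-3)])
    moreover have "card ?O \<le> 1"
      using card_mono[OF _ common_neighbours_subset[OF assms(3)]] by simp
    ultimately show ?thesis using assms(1) by linarith
  next
    case False
    have "S \<inter> (\<circ>) z ` S \<subseteq> ?T \<union> (\<circ>) z ` ?T"
    proof
      fix y
      assume "y \<in> S \<inter> (\<circ>) z ` S"
      then obtain u where u: "u \<in> ?A \<union> ?T" "z \<circ> u \<in> ?A \<union> ?T" "y = z \<circ> u"
        unfolding S_def by (rule Int_comp_imageE)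
      have "z \<circ> u \<in> ?T \<or> u \<in> ?T"
        by (rule star_word_parity(2)[OF assms(2) u(1,2) False])
      then show "y \<in> ?T \<union> (\<circ>) z ` ?T"
        unfolding u(3) by (metis UnI1 UnI2 imageI)
    qed
    then have "card (S \<inter> (\<circ>) z ` S) \<le> card (?T \<union> (\<circ>) z ` ?T)"
      by (intro card_mono) simp_all
    also have "\<dots> \<le> card ?T + card ?T"
      by (intro order_trans[OF card_Un_le] add_mono card_image_le) simp_all
    finally show ?thesis by (simp add: card_prefix_transpositions)
  qed
qed

text \<open>For even \<open>z\<close> neither centre lies in the other ball, leaving at most one
  common neighbour. For odd \<open>z\<close> common neighbours are impossible, leaving only the two
  centres.\<close>

lemma card_ball_1_inter_le:
  assumes "z permutes {1..n}" "z \<noteq> id"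
  defines "S \<equiv> insert id (prefix_transpositions n)"
  shows "card (S \<inter> (\<circ>) z ` S) \<le> 2"
proof -
  let ?T = "prefix_transpositions n"
  note T = prefix_transposition_parity[OF _ assms(1)]
  show ?thesis
  proof (cases "evenperm z")
    case True
    have "S \<inter> (\<circ>) z ` S \<subseteq> ?T \<inter> (\<circ>) z ` ?T"
    proof
      fix y
      assume "y \<in> S \<inter> (\<circ>) z ` S"
      then obtain u where u: "u \<in> S" "z \<circ> u \<in> S" "y = z \<circ> u" by (rule Int_comp_imageE)
      have "u \<noteq> id"
        using u(2) T(1)[of z] True assms(2) unfolding S_def by auto
      then have "u \<in> ?T" using u(1) by (simp add: S_def)
      then have "z \<circ> u \<noteq> id" using T(2)[of u] True by auto
      then have "z \<circ> u \<in> ?T" using u(2) by (simp add: S_def)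
      then show "y \<in> ?T \<inter> (\<circ>) z ` ?T" using \<open>u \<in> ?T\<close> u(3) by simp
    qed
    also have "\<dots> \<subseteq> {transpose 1 (z (z 1))}"
      by (rule common_neighbours_subset[OF assms(2)])
    finally have "card (S \<inter> (\<circ>) z ` S) \<le> card {transpose 1 (z (z 1))}"
      by (intro card_mono) simp_all
    then show ?thesis by simp
  next
    case False
    have "S \<inter> (\<circ>) z ` S \<subseteq> {id, z}"
    proof
      fix y
      assume "y \<in> S \<inter> (\<circ>) z ` S"
      then obtain u where u: "u \<in> S" "z \<circ> u \<in> S" "y = z \<circ> u" by (rule Int_comp_imageE)
      show "y \<in> {id, z}"
      proof (cases "u = id")
        case False
        then have "u \<in> ?T" using u(1) by (simp add: S_def)
        then have "z \<circ> u \<notin> ?T" using T \<open>\<not> evenperm z\<close> by metis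
        then show ?thesis using u(2,3) by (simp add: S_def)
      qed (use u(3) in simp)
    qed
    then have "card (S \<inter> (\<circ>) z ` S) \<le> card {id, z}"
      by (intro card_mono) simp_all
    also have "\<dots> \<le> 2" by (simp add: card_insert_if)
    finally show ?thesis .
  qed
qed

section \<open>From translates of one ball to the maximum\<close>

text \<open>Left multiplication by \<open>x\<close> is injective and carries the intersection of
  \<open>S\<close> with its translate by \<open>z\<close> to that of the balls around
  \<open>x\<close> and \<open>y\<close>, where \<open>z\<close> is the inverse of \<open>x\<close>
  times \<open>y\<close>.\<close>

lemma max_ball_inter_star_eqI:
  assumes ball: "\<And>x. x permutes {1..n} \<Longrightarrow> graph_ball (star_cayley_graph n) r x = (\<circ>) x ` S"
    and le: "\<And>z. z permutes {1..n} \<Longrightarrow> z \<noteq> id \<Longrightarrow> card (S \<inter> (\<circ>) z ` S) \<le> k"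
    and z: "z permutes {1..n}" "z \<noteq> id" "card (S \<inter> (\<circ>) z ` S) = k"
  shows "max_ball_inter (star_cayley_graph n) r = k"
  unfolding max_ball_inter_def verts_star_cayley_graph mem_Collect_eq
proof (rule Max_eqI)
  let ?C = "{card (graph_ball (star_cayley_graph n) r x \<inter> graph_ball (star_cayley_graph n) r y) |x y.
        x permutes {1..n} \<and> y permutes {1..n} \<and> x \<noteq> y}"
  show le_k: "c \<le> k" if "c \<in> ?C" for c
  proof -
    from that obtain x y where xy: "x permutes {1..n}" "y permutes {1..n}" "x \<noteq> y"
      and c: "c = card ((\<circ>) x ` S \<inter> (\<circ>) y ` S)"
      by (auto simp: ball)
    let ?z = "inv_into UNIV x \<circ> y"
    have y: "y = x \<circ> ?z"
      using permutes_inv_o(1)[OF xy(1)] by (simp add: comp_assoc[symmetric])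
    have "inj ((\<circ>) x)"
      by (rule fun.inj_map[OF permutes_inj[OF xy(1)]])
    moreover have "(\<circ>) y ` S = (\<circ>) x ` (\<circ>) ?z ` S"
      unfolding image_image by (subst y) (simp add: comp_assoc)
    ultimately have "c = card (S \<inter> (\<circ>) ?z ` S)"
      unfolding c by (metis image_Int card_image inj_on_subset subset_UNIV)
    moreover have "?z permutes {1..n}"
      by (rule permutes_compose[OF xy(2) permutes_inv[OF xy(1)]])
    moreover have "?z \<noteq> id" using xy(3) y by auto
    ultimately show ?thesis using le by blast
  qed
  \<comment> \<open>Finiteness is free: the values are naturals bounded by \<open>k\<close>.\<close>
  show "finite ?C"
    by (rule finite_subset[of _ "{..k}"]) (use le_k in auto)
  show "k \<in> ?C"
  proof -
    have "k = card (graph_ball (star_cayley_graph n) r id \<inter> graph_ball (star_cayley_graph n) r z)"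
      using z(3) by (simp add: ball[OF z(1)] ball[OF permutes_id])
    then show ?thesis using z(1,2) permutes_id[of "{1..n}"] by blast
  qed
qed

theorem theorem7:
  fixes n :: nat
  assumes "n \<ge> 4"
  shows "max_ball_inter (star_cayley_graph n) 1 = 2 \<and>
         max_ball_inter (star_cayley_graph n) 2 = 2 * (n - 1)"
proof
  let ?T = "prefix_transpositions n" and ?A = "insert id (star_three_cycles n)"
  \<comment> \<open>A neighbour of \<open>id\<close> attains the maximum for both radii.\<close>
  let ?s = "transpose 1 (2::nat)"
  have sT: "?s \<in> ?T" using assms by (auto simp: prefix_transpositions_def)
  have s: "?s permutes {1..n}" "?s \<noteq> id"
    using prefix_transposition_permutes[OF sT] prefix_transposition_parity(1)[OF sT permutes_id]
    by auto
  have ss: "?s \<circ> ?s = id" by simp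
  show "max_ball_inter (star_cayley_graph n) 1 = 2"
  proof (rule max_ball_inter_star_eqI[OF star_ball_1 _ s])
    let ?S = "insert id ?T"
    show "card (?S \<inter> (\<circ>) z ` ?S) \<le> 2" if "z permutes {1..n}" "z \<noteq> id" for z
      by (rule card_ball_1_inter_le[OF that])
    have "{id, ?s} \<subseteq> ?S \<inter> (\<circ>) ?s ` ?S"
      using sT ss by (auto intro!: image_eqI[of id _ ?s])
    then have "card {id, ?s} \<le> card (?S \<inter> (\<circ>) ?s ` ?S)"
      by (intro card_mono) simp_all
    moreover have "card {id, ?s} = 2" using s(2) by auto
    ultimately show "card (?S \<inter> (\<circ>) ?s ` ?S) = 2"
      using card_ball_1_inter_le[OF s] by linarith
  qed
  show "max_ball_inter (star_cayley_graph n) 2 = 2 * (n - 1)"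
  proof (rule max_ball_inter_star_eqI[OF star_ball_2 _ s])
    let ?S = "?A \<union> ?T"
    have n: "n \<ge> 3" using assms by simp
    show "card (?S \<inter> (\<circ>) z ` ?S) \<le> 2 * (n - 1)" if "z permutes {1..n}" "z \<noteq> id" for z
      by (rule card_ball_2_inter_le[OF n that])
    have prod: "?s \<circ> t \<in> ?S" if "t \<in> ?T" for t
      using sT that comp_prefix_transpositions by blast
    \<comment> \<open>Every neighbour of one centre is within distance two of the other, since the
      centres are adjacent.\<close>
    have "?T \<union> (\<circ>) ?s ` ?T \<subseteq> ?S \<inter> (\<circ>) ?s ` ?S"
    proof (intro Un_least subsetI IntI)
      fix t assume t: "t \<in> ?T"
      then show "t \<in> ?S" by simp
      show "t \<in> (\<circ>) ?s ` ?S"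
        by (rule image_eqI[OF _ prod[OF t]]) (simp add: comp_assoc[symmetric])
    next
      fix v assume "v \<in> (\<circ>) ?s ` ?T"
      then obtain t where t: "t \<in> ?T" "v = ?s \<circ> t" by blast
      show "v \<in> ?S" unfolding t(2) by (rule prod[OF t(1)])
      show "v \<in> (\<circ>) ?s ` ?S" unfolding t(2) using t(1) by (intro imageI UnI2)
    qed
    then have "card (?T \<union> (\<circ>) ?s ` ?T) \<le> card (?S \<inter> (\<circ>) ?s ` ?S)"
      by (intro card_mono) simp_all
    moreover have "card (?T \<union> (\<circ>) ?s ` ?T) = card ?T + card ?T"
    proof -
      have "inj ((\<circ>) ?s)" by (rule fun.inj_map[OF permutes_inj[OF s(1)]])
      then have "card ((\<circ>) ?s ` ?T) = card ?T" by (intro card_image) (rule inj_on_subset, auto)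
      \<comment> \<open>Elements of \<open>?T\<close> are odd, those of its translate are
        even.\<close>
      moreover have "?T \<inter> (\<circ>) ?s ` ?T = {}"
        using prefix_transposition_parity[OF _ s(1)] sT by blast
      ultimately show ?thesis by (simp add: card_Un_disjoint)
    qed
    ultimately show "card (?S \<inter> (\<circ>) ?s ` ?S) = 2 * (n - 1)"
      using card_ball_2_inter_le[OF n s] by (simp add: card_prefix_transpositions)
  qed
qed

end
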